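(* Let $m,n\ge 1$ be integers and let the knots satisfy $$t_{-m}=t_{-m+1}=\dots=t_0<t_1<\dots<t_{n-1}<t_n=t_{n+1}=\dots=t_{n+m}.$$ Let $N_{m,-m},N_{m,-m+1},\dots,N_{m,n-1}$ be the B-spline functions of degree $m$ with these knots. Then, for $u\in[t_0,t_n)$, the following relations hold: $$m\,N_{m,-m}(u)+(t_1-u)\,N_{m,-m}'(u)=0,$$ $$N_{mi}(u)+\frac{t_i-u}{m}N_{mi}'(u)=\frac{t_{m+i+1}-t_i}{t_{m+i+2}-t_{i+1}}\left(N_{m,i+1}(u)+\frac{t_{m+i+2}-u}{m}N_{m,i+1}'(u)\right)\qquad(i=-m,-m+1,\dots,n-2),$$ $$m\,N_{m,n-1}(u)+(t_{n-1}-u)\,N_{m,n-1}'(u)=0.$$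
   Context: B-spline functions: for knots $t_i\le t_{i+1}\le\dots\le t_{i+m+1}$, the B-spline (basis) function of degree $m$ is $N_{mi}(u)=(t_{i+m+1}-t_i)\,[t_i,t_{i+1},\dots,t_{i+m+1}](t-u)_+^m$, where the generalized (confluent) divided difference acts on the variable $t$, and $(x-c)_+^m=(x-c)^m$ if $x\ge c$ and $0$ if $x<c$. On $[t_0,t_n)$ the functions are given (with values at the knots taken right-continuously) by the de Boor–Mansfield–Cox recursion: for $i=0,\dots,n-1$, $N_{0i}(u)=1$ if $u\in[t_i,t_{i+1})$ and $N_{0i}(u)=0$ otherwise, and for $p\ge1$, $-p\le i<n$, $$N_{pi}(u)=(u-t_i)\frac{N_{p-1,i}(u)}{t_{p+i}-t_i}+(t_{p+i+1}-u)\frac{N_{p-1,i+1}(u)}{t_{p+i+1}-t_{i+1}},$$ with the conventions that any quotient with zero denominator $t_{m+k+1}-t_k=0$ (or its lower-degree analogue) is $0$, and that $N_{pi}\equiv0$ for $i<-p$ or $i\ge n$. On each knot span $[t_j,t_{j+1})$ $(0\le j\le n-1)$ every $N_{mi}$ coincides with a polynomial; $N_{mi}'$ on that span denotes the derivative of this polynomial (so at a knot it is the right derivative). *)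

theory Defs
  imports Complex_Main "HOL-Computational_Algebra.Polynomial"
begin

(* The B-spline N_{p,i} of degree p, via the de Boor-Mansfield-Cox recursion, which fixes its values
   on [t_0, t_n) (right-continuous at the knots).  Knots are indexed by integers; only the indices
   -p, ..., n+p matter.  Quotients with zero denominator are 0 because x / 0 = 0 in HOL. *)
fun bspline :: "(int \<Rightarrow> real) \<Rightarrow> nat \<Rightarrow> nat \<Rightarrow> int \<Rightarrow> real \<Rightarrow> real" where
  "bspline t n 0 i u =
     (if 0 \<le> i \<and> i < int n \<and> u \<in> {t i..<t (i + 1)} then 1 else 0)"
| "bspline t n (Suc p) i u =
     (if - int (Suc p) \<le> i \<and> i < int n then
        (u - t i) * (bspline t n p i u / (t (int (Suc p) + i) - t i))
      + (t (int (Suc p) + i + 1) - u)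
          * (bspline t n p (i + 1) u / (t (int (Suc p) + i + 1) - t (i + 1)))
      else 0)"

(* N_{m,i}'(u): the derivative at u of the polynomial that agrees with N_{m,i} on the knot span
   [t_j, t_{j+1}) containing u.  At a knot this is the right derivative.  For u in [t_0, t_n) and
   t_0 < ... < t_n the description is satisfied by exactly one value; see bspline_span_poly_ex
   and bspline_deriv_eqI. *)
definition bspline_deriv :: "(int \<Rightarrow> real) \<Rightarrow> nat \<Rightarrow> nat \<Rightarrow> int \<Rightarrow> real \<Rightarrow> real" where
  "bspline_deriv t n m i u =
     (THE d. \<exists>j q. 0 \<le> j \<and> j < int n \<and> u \<in> {t j..<t (j + 1)}
        \<and> (\<forall>x\<in>{t j..<t (j + 1)}. bspline t n m i x = poly q x)
        \<and> d = poly (pderiv q) u)"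

lemma knots_mono:
  fixes t :: "int \<Rightarrow> real"
  assumes inc: "\<forall>i. 0 \<le> i \<and> i < int n \<longrightarrow> t i < t (i + 1)"
    and "0 \<le> i" "i \<le> j" "j \<le> int n"
  shows "t i \<le> t j"
  using \<open>i \<le> j\<close> \<open>j \<le> int n\<close>
proof (induction j rule: int_ge_induct)
  case base
  then show ?case by simp
next
  case (step k)
  then have "t k < t (k + 1)" using inc[rule_format, of k] \<open>0 \<le> i\<close> by linarith
  moreover have "t i \<le> t k" using step by linarith
  ultimately show ?case by linarith
qed

lemma knot_span_unique:
  fixes t :: "int \<Rightarrow> real"
  assumes inc: "\<forall>i. 0 \<le> i \<and> i < int n \<longrightarrow> t i < t (i + 1)"
    and "0 \<le> j" "j < int n" "u \<in> {t j..<t (j + 1)}"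
    and "0 \<le> k" "k < int n" "u \<in> {t k..<t (k + 1)}"
  shows "j = k"
proof (rule ccontr)
  assume "j \<noteq> k"
  then consider "j + 1 \<le> k" | "k + 1 \<le> j" by linarith
  then show False
  proof cases
    case 1
    then have "t (j + 1) \<le> t k" using knots_mono[OF inc, of "j + 1" k] assms(2,3,5,6) by linarith
    with assms(4,7) show False by auto
  next
    case 2
    then have "t (k + 1) \<le> t j" using knots_mono[OF inc, of "k + 1" j] assms(2,3,5,6) by linarith
    with assms(4,7) show False by auto
  qed
qed

lemma bspline_span_poly_ex:
  assumes inc: "\<forall>i. 0 \<le> i \<and> i < int n \<longrightarrow> t i < t (i + 1)"
    and j: "0 \<le> j" "j < int n"
  shows "\<exists>q. \<forall>x\<in>{t j..<t (j + 1)}. bspline t n m i x = poly q x"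
proof (induction m arbitrary: i)
  case 0
  show ?case
  proof (rule exI[of _ "[:if i = j then 1 else 0:]"], rule ballI)
    fix x assume x: "x \<in> {t j..<t (j + 1)}"
    show "bspline t n 0 i x = poly [:if i = j then 1 else 0:] x"
    proof (cases "i = j")
      case True
      then show ?thesis using j x by (simp del: atLeastLessThan_iff)
    next
      case False
      then have "\<not> (0 \<le> i \<and> i < int n \<and> x \<in> {t i..<t (i + 1)})"
        using knot_span_unique[OF inc j x, of i] by blast
      then show ?thesis using False by (simp del: atLeastLessThan_iff)
    qed
  qed
next
  case (Suc p)
  obtain a where a: "\<forall>x\<in>{t j..<t (j + 1)}. bspline t n p i x = poly a x"
    using Suc by blast
  obtain b where b: "\<forall>x\<in>{t j..<t (j + 1)}. bspline t n p (i + 1) x = poly b x"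
    using Suc by blast
  let ?D = "t (int (Suc p) + i) - t i" and ?E = "t (int (Suc p) + i + 1) - t (i + 1)"
  let ?q = "[:- t i, 1:] * smult (1 / ?D) a + [:t (int (Suc p) + i + 1), -1:] * smult (1 / ?E) b"
  show ?case
  proof (cases "- int (Suc p) \<le> i \<and> i < int n")
    case True
    show ?thesis
    proof (rule exI[of _ ?q], rule ballI)
      fix x assume "x \<in> {t j..<t (j + 1)}"
      then have "bspline t n p i x = poly a x" "bspline t n p (i + 1) x = poly b x"
        using a b by blast+
      then show "bspline t n (Suc p) i x = poly ?q x"
        unfolding bspline.simps(2) if_P[OF True]
        by (simp only: poly_add poly_mult poly_smult poly_pCons poly_0
              mult_zero_right add_0_right mult_1_right mult_minus1_right times_divide_eq_left
              mult_1_left) (simp only: uminus_add_conv_diff diff_conv_add_uminus [symmetric])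
    qed
  next
    case False
    then have "\<forall>x. bspline t n (Suc p) i x = poly 0 x"
      unfolding bspline.simps(2) by (simp only: if_False poly_0 simp_thms)
    then show ?thesis by blast

  qed
qed

lemma bspline_deriv_eqI:
  assumes inc: "\<forall>i. 0 \<le> i \<and> i < int n \<longrightarrow> t i < t (i + 1)"
    and j: "0 \<le> j" "j < int n" and u: "u \<in> {t j..<t (j + 1)}"
    and q: "\<forall>x\<in>{t j..<t (j + 1)}. bspline t n m i x = poly q x"
  shows "bspline_deriv t n m i u = poly (pderiv q) u"
  unfolding bspline_deriv_def
proof (rule the_equality)
  show "\<exists>j r. 0 \<le> j \<and> j < int n \<and> u \<in> {t j..<t (j + 1)}
        \<and> (\<forall>x\<in>{t j..<t (j + 1)}. bspline t n m i x = poly r x)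
        \<and> poly (pderiv q) u = poly (pderiv r) u"
    using j u q by blast
next
  fix d
  assume "\<exists>j r. 0 \<le> j \<and> j < int n \<and> u \<in> {t j..<t (j + 1)}
        \<and> (\<forall>x\<in>{t j..<t (j + 1)}. bspline t n m i x = poly r x)
        \<and> d = poly (pderiv r) u"
  then obtain k r where k: "0 \<le> k" "k < int n" "u \<in> {t k..<t (k + 1)}"
    and r: "\<forall>x\<in>{t k..<t (k + 1)}. bspline t n m i x = poly r x"
    and d: "d = poly (pderiv r) u" by blast
  have "k = j" using knot_span_unique[OF inc k j u] .
  have "{t j..<t (j + 1)} \<subseteq> {x. poly (q - r) x = 0}"
    using q r \<open>k = j\<close> by auto
  moreover have "infinite {t j..<t (j + 1)}" using inc[rule_format, of j] j by (simp add: infinite_Ico)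
  ultimately have "q - r = 0" using poly_roots_finite finite_subset by blast
  then show "d = poly (pderiv q) u" using d by simp
qed

end

theory Submission
  imports Defs
begin

text \<open>
  Write \<open>M\<^sub>p\<^sub>i = N\<^sub>p\<^sub>i / (t\<^sub>p\<^sub>+\<^sub>i\<^sub>+\<^sub>1 - t\<^sub>i)\<close>.  The recursion reads
  \<open>N\<^sub>m\<^sub>i(u) = (u - t\<^sub>i) A + (t\<^sub>m\<^sub>+\<^sub>i\<^sub>+\<^sub>1 - u) B\<close> with \<open>A = M\<close> of degree \<open>m - 1\<close> and index \<open>i\<close>, and
  \<open>B\<close> its right neighbour of index \<open>i + 1\<close>.  The classical derivative formula says
  \<open>N\<^sub>m\<^sub>i' = m (A - B)\<close>.  Substituting it makes one of the two neighbours drop out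
  (lemma \<open>bspline_eliminate_neighbour\<close>, written there with the factors
  \<open>u - t\<^sub>i\<close> and \<open>t\<^sub>m\<^sub>+\<^sub>i\<^sub>+\<^sub>1 - u\<close> on the derivative):
  \<open>N\<^sub>m\<^sub>i + (t\<^sub>i - u)/m N\<^sub>m\<^sub>i'\<close> is a multiple of \<open>B\<close> alone, and
  \<open>N\<^sub>m\<^sub>i + (t\<^sub>m\<^sub>+\<^sub>i\<^sub>+\<^sub>1 - u)/m N\<^sub>m\<^sub>i'\<close> is a multiple of \<open>A\<close> alone.
  Since the right neighbour of index \<open>i\<close> is the left neighbour of index \<open>i + 1\<close>, the
  relation between consecutive B-splines only compares the two factors, which are the lengths
  of the two supports.  At both ends of the
  index range the surviving neighbour is a function outside the range, hence zero, which gives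
  the first and the last relation.

  The derivative formula is proved by induction on the degree
  (lemma \<open>bspline_deriv_Suc_eq_diff\<close>).  The same elimination at the
  lower degree turns the two terms of the product rule that contain derivatives into a telescoping
  sum.  The only delicate point is the vanishing denominators: the clamped knots make
  \<open>t\<^sub>p\<^sub>+\<^sub>i\<^sub>+\<^sub>1 - t\<^sub>i\<close> positive for every index \<open>-p \<le> i < n\<close>, so a zero denominator
  only occurs together with a zero B-spline.
\<close>

section \<open>Clamped knot vectors\<close>

text \<open>
  The end knots are repeated often enough for every degree up to \<open>m\<close>, so one knot vector
  serves the whole induction on the degree.
\<close>

locale clamped_knots =
  fixes t :: "int \<Rightarrow> real" and n m :: nat
  assumes nonempty: "n \<ge> 1"
    and left_end: "\<forall>i. - int m \<le> i \<and> i \<le> 0 \<longrightarrow> t i = t 0"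
    and increasing: "\<forall>i. 0 \<le> i \<and> i < int n \<longrightarrow> t i < t (i + 1)"
    and right_end: "\<forall>i. int n \<le> i \<and> i \<le> int n + int m \<longrightarrow> t i = t (int n)"
begin

definition scaled_bspline :: "nat \<Rightarrow> int \<Rightarrow> real \<Rightarrow> real" where
  "scaled_bspline p i u = bspline t n p i u / (t (int (Suc p) + i) - t i)"

definition scaled_bspline_deriv :: "nat \<Rightarrow> int \<Rightarrow> real \<Rightarrow> real" where
  "scaled_bspline_deriv p i u = bspline_deriv t n p i u / (t (int (Suc p) + i) - t i)"

lemma bspline_outside: "i < - int p \<or> int n \<le> i \<Longrightarrow> bspline t n p i u = 0"
  by (cases p) auto

lemma scaled_bspline_outside: "i < - int p \<or> int n \<le> i \<Longrightarrow> scaled_bspline p i u = 0"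
  by (simp add: scaled_bspline_def bspline_outside del: bspline.simps)

text \<open>
  The support of an admissible B-spline contains a nondegenerate knot span: moving both indices
  into \<open>{0..n}\<close> changes neither knot and leaves the indices distinct.
\<close>

lemma support_length_pos:
  assumes "p \<le> m" "- int p \<le> i" "i < int n"
  shows "t i < t (int (Suc p) + i)"
proof -
  have lo: "t i = t (max 0 i)"
    using assms left_end[rule_format, of i] by (cases "i \<le> 0") auto
  have hi: "t (int (Suc p) + i) = t (min (int n) (int (Suc p) + i))"
    using assms right_end[rule_format, of "int (Suc p) + i"]
    by (cases "int n \<le> int (Suc p) + i") auto
  have "t (max 0 i) < t (max 0 i + 1)"
    using assms nonempty increasing[rule_format, of "max 0 i"] by simp
  also have "\<dots> \<le> t (min (int n) (int (Suc p) + i))"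
    using assms nonempty by (intro knots_mono[OF increasing]) auto
  finally show ?thesis
    using lo hi by simp
qed

lemma knot_span_ex:
  assumes "u \<in> {t 0..<t (int n)}"
  obtains j where "0 \<le> j" "j < int n" "u \<in> {t j..<t (j + 1)}"
proof -
  have "u < t (int k) \<Longrightarrow> \<exists>j. 0 \<le> j \<and> j < int k \<and> u \<in> {t j..<t (j + 1)}" for k
  proof (induction k)
    case 0
    then show ?case using assms by simp
  next
    case (Suc k)
    show ?case
    proof (cases "u < t (int k)")
      case True
      then show ?thesis using Suc.IH by fastforce
    next
      case False
      then show ?thesis using Suc.prems by (intro exI[of _ "int k"]) (auto simp: add.commute)
    qed
  qed
  then show ?thesis using assms that by auto
qed

section \<open>The recursion and the product rule\<close>

text \<open>
  Outside the index range both scaled B-splines on the right vanish as well, so the recursion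
  holds for every index and later arguments need no distinction at the two ends.
\<close>

lemma bspline_Suc:
  "bspline t n (Suc p) i u = (u - t i) * scaled_bspline p i u
     + (t (int (Suc p) + i + 1) - u) * scaled_bspline p (i + 1) u"
proof (cases "- int (Suc p) \<le> i \<and> i < int n")
  case True
  then show ?thesis
    unfolding bspline.simps(2) if_P[OF True] scaled_bspline_def by (simp add: add.assoc)
next
  case False
  then have "i < - int p \<or> int n \<le> i" "i + 1 < - int p \<or> int n \<le> i + 1"
    "i < - int (Suc p) \<or> int n \<le> i"
    by auto
  then show ?thesis
    by (simp add: scaled_bspline_outside bspline_outside del: bspline.simps)
qed

lemma bspline_deriv_0:
  assumes "u \<in> {t 0..<t (int n)}"
  shows "bspline_deriv t n 0 i u = 0"
proof -
  obtain j where j: "0 \<le> j" "j < int n" "u \<in> {t j..<t (j + 1)}"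
    using knot_span_ex[OF assms] .
  have "\<forall>x\<in>{t j..<t (j + 1)}. bspline t n 0 i x = poly [:if i = j then 1 else 0:] x"
  proof
    fix x assume x: "x \<in> {t j..<t (j + 1)}"
    show "bspline t n 0 i x = poly [:if i = j then 1 else 0:] x"
      using knot_span_unique[OF increasing j(1,2) x, of i] j(1,2) x
      by (cases "i = j") (auto simp del: atLeastLessThan_iff)
  qed
  from bspline_deriv_eqI[OF increasing j this] show ?thesis
    by (simp add: pderiv_pCons)
qed

lemma bspline_deriv_outside:
  assumes "u \<in> {t 0..<t (int n)}" "i < - int p \<or> int n \<le> i"
  shows "bspline_deriv t n p i u = 0"
proof -
  obtain j where j: "0 \<le> j" "j < int n" "u \<in> {t j..<t (j + 1)}"
    using knot_span_ex[OF assms(1)] .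
  have "\<forall>x\<in>{t j..<t (j + 1)}. bspline t n p i x = poly 0 x"
    using assms(2) by (simp add: bspline_outside del: bspline.simps)
  from bspline_deriv_eqI[OF increasing j this] show ?thesis by simp
qed

text \<open>
  The product rule, applied to the recursion with the B-splines replaced by the polynomials that
  represent them on the knot span of \<open>u\<close>.
\<close>

lemma bspline_deriv_Suc:
  assumes "u \<in> {t 0..<t (int n)}"
  shows "bspline_deriv t n (Suc p) i u
    = scaled_bspline p i u - scaled_bspline p (i + 1) u
      + (u - t i) * scaled_bspline_deriv p i u
      + (t (int (Suc p) + i + 1) - u) * scaled_bspline_deriv p (i + 1) u"
proof -
  obtain j where j: "0 \<le> j" "j < int n" "u \<in> {t j..<t (j + 1)}"
    using knot_span_ex[OF assms] .
  obtain a where a: "\<forall>x\<in>{t j..<t (j + 1)}. bspline t n p i x = poly a x"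
    using bspline_span_poly_ex[OF increasing j(1,2)] by blast
  obtain b where b: "\<forall>x\<in>{t j..<t (j + 1)}. bspline t n p (i + 1) x = poly b x"
    using bspline_span_poly_ex[OF increasing j(1,2)] by blast
  define D where "D = t (int (Suc p) + i) - t i"
  define E where "E = t (int (Suc p) + (i + 1)) - t (i + 1)"
  define q where "q = [:- t i, 1:] * smult (1 / D) a
    + [:t (int (Suc p) + i + 1), -1:] * smult (1 / E) b"
  have "\<forall>x\<in>{t j..<t (j + 1)}. bspline t n (Suc p) i x = poly q x"
  proof
    fix x assume "x \<in> {t j..<t (j + 1)}"
    with a b show "bspline t n (Suc p) i x = poly q x"
      unfolding bspline_Suc scaled_bspline_def D_def[symmetric] E_def[symmetric] q_def
      by (simp del: bspline.simps add: algebra_simps flip: add_divide_distrib)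
  qed
  then have "bspline_deriv t n (Suc p) i u = poly (pderiv q) u"
    by (rule bspline_deriv_eqI[OF increasing j])
  moreover have "bspline t n p i u = poly a u" "bspline t n p (i + 1) u = poly b u"
    using a b j(3) by blast+
  moreover have "bspline_deriv t n p i u = poly (pderiv a) u"
    "bspline_deriv t n p (i + 1) u = poly (pderiv b) u"
    using bspline_deriv_eqI[OF increasing j] a b by blast+
  moreover have "poly (pderiv q) u = poly a u / D - poly b u / E
      + (u - t i) * (poly (pderiv a) u / D)
      + (t (int (Suc p) + i + 1) - u) * (poly (pderiv b) u / E)"
    unfolding q_def pderiv_add pderiv_mult pderiv_smult pderiv_pCons
    by (simp add: left_diff_distrib)
  ultimately show ?thesis
    unfolding scaled_bspline_def scaled_bspline_deriv_def D_def[symmetric] E_def[symmetric]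
    by (simp only:)
qed

section \<open>The derivative formula\<close>

text \<open>
  Once the derivative is a multiple of the difference of the two neighbours of lower degree, the
  multiplier \<open>u - t\<^sub>i\<close> or \<open>t\<^sub>p\<^sub>+\<^sub>i\<^sub>+\<^sub>2 - u\<close> is the one for which the recursion removes one of
  them; the other one is left with the full length of the support as its factor.
\<close>

lemma bspline_eliminate_neighbour:
  assumes "bspline_deriv t n (Suc p) i u
    = real (Suc p) * (scaled_bspline p i u - scaled_bspline p (i + 1) u)"
  shows "(u - t i) * bspline_deriv t n (Suc p) i u
      = real (Suc p) * (bspline t n (Suc p) i u
          - (t (int (Suc p) + i + 1) - t i) * scaled_bspline p (i + 1) u)"
    and "(t (int (Suc p) + i + 1) - u) * bspline_deriv t n (Suc p) i u
      = real (Suc p) * ((t (int (Suc p) + i + 1) - t i) * scaled_bspline p i u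
          - bspline t n (Suc p) i u)"
  unfolding assms bspline_Suc by (simp_all add: algebra_simps)

text \<open>
  The elimination, divided by the length of the support.  For an index outside the range that
  length may be zero; there both sides vanish, because every B-spline involved, of either
  degree, is then outside its range.
\<close>

lemma scaled_bspline_eliminate_neighbour:
  assumes u: "u \<in> {t 0..<t (int n)}" and p: "Suc p \<le> m"
    and deriv: "bspline_deriv t n (Suc p) i u
      = real (Suc p) * (scaled_bspline p i u - scaled_bspline p (i + 1) u)"
  shows "(u - t i) * scaled_bspline_deriv (Suc p) i u
      = real (Suc p) * (scaled_bspline (Suc p) i u - scaled_bspline p (i + 1) u)"
    and "(t (int (Suc p) + i + 1) - u) * scaled_bspline_deriv (Suc p) i u
      = real (Suc p) * (scaled_bspline p i u - scaled_bspline (Suc p) i u)"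
proof -
  define L where "L = t (int (Suc p) + i + 1) - t i"
  have L: "t (int (Suc (Suc p)) + i) - t i = L"
    unfolding L_def by (simp add: algebra_simps)
  have "(u - t i) * scaled_bspline_deriv (Suc p) i u
      = real (Suc p) * (scaled_bspline (Suc p) i u - scaled_bspline p (i + 1) u)
    \<and> (t (int (Suc p) + i + 1) - u) * scaled_bspline_deriv (Suc p) i u
      = real (Suc p) * (scaled_bspline p i u - scaled_bspline (Suc p) i u)"
  proof (cases "- int (Suc p) \<le> i \<and> i < int n")
    case True
    then have "L \<noteq> 0"
      using support_length_pos[of "Suc p" i] p L by auto
    moreover note bspline_eliminate_neighbour[OF deriv, folded L_def]
    ultimately show ?thesis
      unfolding scaled_bspline_deriv_def scaled_bspline_def[of "Suc p"] L
      by (simp add: divide_simps del: bspline.simps of_nat_Suc)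
  next
    case False
    then have "i < - int p \<or> int n \<le> i" "i + 1 < - int p \<or> int n \<le> i + 1"
      "i < - int (Suc p) \<or> int n \<le> i"
      by auto
    then show ?thesis
      by (simp add: scaled_bspline_outside scaled_bspline_deriv_def bspline_deriv_outside[OF u])
  qed
  then show "(u - t i) * scaled_bspline_deriv (Suc p) i u
      = real (Suc p) * (scaled_bspline (Suc p) i u - scaled_bspline p (i + 1) u)"
    and "(t (int (Suc p) + i + 1) - u) * scaled_bspline_deriv (Suc p) i u
      = real (Suc p) * (scaled_bspline p i u - scaled_bspline (Suc p) i u)"
    by blast+
qed

text \<open>
  In the induction step the product rule already supplies one copy of the difference; the two
  terms that contain derivatives supply the missing \<open>p + 1\<close> copies, by the elimination above.
\<close>

lemma bspline_deriv_Suc_eq_diff: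
  assumes u: "u \<in> {t 0..<t (int n)}" and "Suc p \<le> m"
  shows "bspline_deriv t n (Suc p) i u
    = real (Suc p) * (scaled_bspline p i u - scaled_bspline p (i + 1) u)"
  using \<open>Suc p \<le> m\<close>
proof (induction p arbitrary: i)
  case 0
  then show ?case
    by (simp add: bspline_deriv_Suc[OF u] scaled_bspline_deriv_def bspline_deriv_0[OF u])
next
  case (Suc p)
  then have p: "Suc p \<le> m" by simp
  note IH = Suc.IH[OF p]
  have left: "(u - t i) * scaled_bspline_deriv (Suc p) i u
      = real (Suc p) * (scaled_bspline (Suc p) i u - scaled_bspline p (i + 1) u)"
    by (rule scaled_bspline_eliminate_neighbour(1)[OF u p IH])
  have right: "(t (int (Suc (Suc p)) + i + 1) - u) * scaled_bspline_deriv (Suc p) (i + 1) u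
      = real (Suc p) * (scaled_bspline p (i + 1) u - scaled_bspline (Suc p) (i + 1) u)"
    using scaled_bspline_eliminate_neighbour(2)[OF u p IH, of "i + 1"]
    by (simp add: algebra_simps)
  \<comment> \<open>The degree \<open>p\<close> function of index \<open>i + 1\<close> cancels between \<open>left\<close> and \<open>right\<close>.\<close>
  show ?case
    unfolding bspline_deriv_Suc[OF u] left right by (simp add: algebra_simps)
qed

end

theorem theorem3p1:
  fixes m n :: nat and t :: "int \<Rightarrow> real"
  assumes "m \<ge> 1" and "n \<ge> 1"
    and "\<forall>i. - int m \<le> i \<and> i \<le> 0 \<longrightarrow> t i = t 0"
    and "\<forall>i. 0 \<le> i \<and> i < int n \<longrightarrow> t i < t (i + 1)"
    and "\<forall>i. int n \<le> i \<and> i \<le> int n + int m \<longrightarrow> t i = t (int n)"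
  shows "\<forall>u\<in>{t 0..<t (int n)}.
      real m * bspline t n m (- int m) u + (t 1 - u) * bspline_deriv t n m (- int m) u = 0
    \<and> (\<forall>i. - int m \<le> i \<and> i \<le> int n - 2 \<longrightarrow>
          bspline t n m i u + (t i - u) / real m * bspline_deriv t n m i u
          = (t (int m + i + 1) - t i) / (t (int m + i + 2) - t (i + 1))
            * (bspline t n m (i + 1) u
               + (t (int m + i + 2) - u) / real m * bspline_deriv t n m (i + 1) u))
    \<and> real m * bspline t n m (int n - 1) u
        + (t (int n - 1) - u) * bspline_deriv t n m (int n - 1) u = 0"
proof
  interpret clamped_knots t n m
    using assms by unfold_locales
  fix u assume u: "u \<in> {t 0..<t (int n)}"
  obtain p where m: "m = Suc p"
    using \<open>m \<ge> 1\<close> by (cases m) auto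
  have deriv: "bspline_deriv t n m i u
      = real m * (scaled_bspline p i u - scaled_bspline p (i + 1) u)" for i
    unfolding m by (rule bspline_deriv_Suc_eq_diff[OF u]) (simp add: m)
  note eliminate = bspline_eliminate_neighbour[OF deriv[unfolded m], folded m]
  have left_vanishes: "scaled_bspline p (- int m) u = 0"
    by (rule scaled_bspline_outside) (simp add: m)
  have right_vanishes: "scaled_bspline p (int n) u = 0"
    by (rule scaled_bspline_outside) simp
  have "real m * bspline t n m (- int m) u + (t 1 - u) * bspline_deriv t n m (- int m) u = 0"
    using eliminate(2)[of "- int m"] left_vanishes
    by (simp add: algebra_simps del: bspline.simps)
  moreover have "real m * bspline t n m (int n - 1) u
      + (t (int n - 1) - u) * bspline_deriv t n m (int n - 1) u = 0"
    using eliminate(1)[of "int n - 1"] right_vanishes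
    by (simp add: algebra_simps del: bspline.simps)
  moreover have "bspline t n m i u + (t i - u) / real m * bspline_deriv t n m i u
      = (t (int m + i + 1) - t i) / (t (int m + i + 2) - t (i + 1))
        * (bspline t n m (i + 1) u
           + (t (int m + i + 2) - u) / real m * bspline_deriv t n m (i + 1) u)"
    if i: "- int m \<le> i \<and> i \<le> int n - 2" for i
  proof -
    define L where "L = t (int m + i + 1) - t i"
    define L' where "L' = t (int m + i + 2) - t (i + 1)"
    have "L' \<noteq> 0"
      using support_length_pos[of m "i + 1"] i by (simp add: L'_def algebra_simps)
    have "bspline t n m i u + (t i - u) / real m * bspline_deriv t n m i u
        = L * scaled_bspline p (i + 1) u"
      using eliminate(1)[of i, folded L_def] \<open>m \<ge> 1\<close>
      by (simp add: field_simps del: bspline.simps)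
    moreover have "bspline t n m (i + 1) u
        + (t (int m + i + 2) - u) / real m * bspline_deriv t n m (i + 1) u
        = L' * scaled_bspline p (i + 1) u"
    proof -
      have "int m + (i + 1) + 1 = int m + i + 2" by simp
      from eliminate(2)[of "i + 1", unfolded this, folded L'_def] \<open>m \<ge> 1\<close> show ?thesis
        by (simp add: field_simps del: bspline.simps)
    qed
    ultimately show ?thesis
      using \<open>L' \<noteq> 0\<close> unfolding L_def[symmetric] L'_def[symmetric]
      by (simp del: bspline.simps)
  qed
  ultimately show "real m * bspline t n m (- int m) u
      + (t 1 - u) * bspline_deriv t n m (- int m) u = 0
    \<and> (\<forall>i. - int m \<le> i \<and> i \<le> int n - 2 \<longrightarrow>
          bspline t n m i u + (t i - u) / real m * bspline_deriv t n m i u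
          = (t (int m + i + 1) - t i) / (t (int m + i + 2) - t (i + 1))
            * (bspline t n m (i + 1) u
               + (t (int m + i + 2) - u) / real m * bspline_deriv t n m (i + 1) u))
    \<and> real m * bspline t n m (int n - 1) u
        + (t (int n - 1) - u) * bspline_deriv t n m (int n - 1) u = 0"
    by blast
qed

end
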